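(* Let $F$ be the face of $P_{\mathrm{utt}}(n)$ consisting of all its points satisfying the equations $$\sum_{j\in V\setminus\{i\}}y_{t,i,j}=1\quad\forall i,t\in V,\ i\ne t,\qquad \sum_{i\in V\setminus\{j\}}y_{t,i,j}=1\quad\forall j,t\in V,\ j\ne t.$$ Then $F=\mathrm{conv}\{(\chi(T),\psi(T)) : T\text{ tournament}\}$. Consequently, the system (F0)–(F7) below together with these equations is an integer programming formulation for this polytope, i.e., the convex hull of its feasible (integral) points equals $\mathrm{conv}\{(\chi(T),\psi(T)) : T\text{ tournament}\}$.
   Context: Let $n\ge4$ be even, $V=\{1,\dots,n\}$ (teams; team $i$ has home venue $i$), $S=\{1,\dots,2n-2\}$ (slots), $A=\{(i,j)\in V\times V:i\ne j\}$, $\mathcal M=\{(k,i,j):k\in S,(i,j)\in A\}$, where $(k,i,j)$ denotes the match between $i$ and $j$ at venue $i$ in slot $k$. Coordinates are $x_{k,i,j}$ ($(k,i,j)\in\mathcal M$) and $y_{t,i,j}$ ($t\in V$, $(i,j)\in A$). The system: (F0) $\sum_{j\in V\setminus\{i\}}(x_{k,i,j}+x_{k,j,i})=1$ for $k\in S$, $k\ge2$, $i\in V$; (F1) $\sum_{k\in S}x_{k,i,j}=1$ for $(i,j)\in A$; (F2) $x_{k,i,t}+x_{k+1,j,t}-1\le y_{t,i,j}$ for $k\in S\setminus\{2n-2\}$, $(i,j)\in A$, $t\in V\setminus\{i,j\}$; (F3) $\sum_{i\in V\setminus\{t\}}x_{k,t,i}+x_{k+1,j,t}-1\le y_{t,t,j}$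 for $k\in S\setminus\{2n-2\}$, $(t,j)\in A$; (F4) $x_{k-1,i,t}+\sum_{j\in V\setminus\{t\}}x_{k,t,j}-1\le y_{t,i,t}$ for $k\in S\setminus\{1\}$, $(i,t)\in A$; (F5) $x_{1,j,t}\le y_{t,t,j}$ for $(t,j)\in A$; (F6) $x_{2n-2,i,t}\le y_{t,i,t}$ for $(i,t)\in A$; (F7) $x\in\{0,1\}^{\mathcal M}$, $y\in\{0,1\}^{V\times A}$. A tournament is a set $T\subseteq\mathcal M$ whose incidence vector $\chi(T)$ satisfies (F0) and (F1). In $T$, team $t$ is at venue $t$ in a slot where it plays at home and at venue $i$ in slot $k$ if $(k,i,t)\in T$; before slot 1 and after slot $2n-2$ it is at venue $t$. Team $t$ travels from venue $i$ to venue $j\ne i$ if it is at $i$ and then at $j$ at consecutive positions of (start, slot $1$, …, slot $2n-2$, end). The travel vector $\psi(T)\in\{0,1\}^{V\times A}$ has $\psi(T)_{t,i,j}=1$ iff team $t$ travels from $i$ to $j$. $P_{\mathrm{utt}}(n)=\mathrm{conv}\{(\chi(T),y)\in\{0,1\}^{\mathcal M}\times\{0,1\}^{V\times A}: T\text{ tournament},\ y\ge\psi(T)\}$; the inequalities $\sum_{j\ne i}y_{t,i,j}\ge1$ and $\sum_{i\ne j}y_{t,i,j}\ge1$ (for $i\ne t$, resp. $j\ne t$) are valid for it. *)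

theory Defs
  imports "HOL-Analysis.Analysis" "HOL-Library.Function_Algebras"
begin

(* Pointwise vector space structure on functions. It makes the library's convex hull and face_of
   available for vectors with an explicit, n-dependent finite index set I, represented as
   functions that vanish outside I. *)
instantiation "fun" :: (type, real_vector) real_vector
begin

definition scaleR_fun :: "real \<Rightarrow> ('a \<Rightarrow> 'b) \<Rightarrow> 'a \<Rightarrow> 'b" where
  "scaleR_fun c f = (\<lambda>i. c *\<^sub>R f i)"

instance
  by standard (auto simp: scaleR_fun_def fun_eq_iff scaleR_add_right scaleR_add_left)

end

(* The vectors of {0,1}^I, extended by 0 outside I. *)
definition binary_vectors :: "'i set \<Rightarrow> ('i \<Rightarrow> real) set" where
  "binary_vectors I = {f. (\<forall>i\<in>I. f i \<in> {0, 1}) \<and> (\<forall>i. i \<notin> I \<longrightarrow> f i = 0)}"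

definition teams :: "nat \<Rightarrow> nat set" where
  "teams n = {1..n}"

definition slots :: "nat \<Rightarrow> nat set" where
  "slots n = {1..2 * n - 2}"

definition arcs :: "nat \<Rightarrow> (nat \<times> nat) set" where
  "arcs n = {(i, j). i \<in> teams n \<and> j \<in> teams n \<and> i \<noteq> j}"

(* (k, i, j) is the match between i and j at venue i in slot k. *)
definition matches :: "nat \<Rightarrow> (nat \<times> nat \<times> nat) set" where
  "matches n = slots n \<times> arcs n"

definition one_match_per_slot :: "nat \<Rightarrow> (nat \<times> nat \<times> nat \<Rightarrow> real) \<Rightarrow> bool" where
  "one_match_per_slot n x \<longleftrightarrow>
     (\<forall>k\<in>slots n. k \<ge> 2 \<longrightarrow>
        (\<forall>i\<in>teams n. (\<Sum>j\<in>teams n - {i}. x (k, i, j) + x (k, j, i)) = 1))"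

definition each_match_once :: "nat \<Rightarrow> (nat \<times> nat \<times> nat \<Rightarrow> real) \<Rightarrow> bool" where
  "each_match_once n x \<longleftrightarrow> (\<forall>(i, j)\<in>arcs n. (\<Sum>k\<in>slots n. x (k, i, j)) = 1)"

(* Slot 1 is not mentioned in one_match_per_slot: for incidence vectors, its equations follow from
   those for the other slots together with each_match_once. *)
definition tournament :: "nat \<Rightarrow> (nat \<times> nat \<times> nat) set \<Rightarrow> bool" where
  "tournament n T \<longleftrightarrow>
     T \<subseteq> matches n \<and> one_match_per_slot n (indicator T) \<and> each_match_once n (indicator T)"

(* Team t is at venue v at position p. Position 0 is the start, positions 1, ..., 2n-2 are the slots
   and position 2n-1 is the end. *)
definition at_venue :: "nat \<Rightarrow> (nat \<times> nat \<times> nat) set \<Rightarrow> nat \<Rightarrow> nat \<Rightarrow> nat \<Rightarrow> bool" where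
  "at_venue n T t p v \<longleftrightarrow>
     (p = 0 \<or> p = 2 * n - 1) \<and> v = t
     \<or> p \<in> slots n \<and> v = t \<and> (\<exists>j\<in>teams n - {t}. (p, t, j) \<in> T)
     \<or> p \<in> slots n \<and> v \<noteq> t \<and> (p, v, t) \<in> T"

definition travels :: "nat \<Rightarrow> (nat \<times> nat \<times> nat) set \<Rightarrow> nat \<Rightarrow> nat \<Rightarrow> nat \<Rightarrow> bool" where
  "travels n T t i j \<longleftrightarrow>
     i \<noteq> j \<and> (\<exists>p \<le> 2 * n - 2. at_venue n T t p i \<and> at_venue n T t (Suc p) j)"

definition travel_vector :: "nat \<Rightarrow> (nat \<times> nat \<times> nat) set \<Rightarrow> nat \<times> nat \<times> nat \<Rightarrow> real" where
  "travel_vector n T = indicator {(t, i, j) \<in> teams n \<times> arcs n. travels n T t i j}"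

definition P_utt :: "nat \<Rightarrow> ((nat \<times> nat \<times> nat \<Rightarrow> real) \<times> (nat \<times> nat \<times> nat \<Rightarrow> real)) set" where
  "P_utt n = convex hull
     {(indicator T, y) | T y.
        tournament n T \<and> y \<in> binary_vectors (teams n \<times> arcs n) \<and> travel_vector n T \<le> y}"

definition exact_travel_polytope ::
    "nat \<Rightarrow> ((nat \<times> nat \<times> nat \<Rightarrow> real) \<times> (nat \<times> nat \<times> nat \<Rightarrow> real)) set" where
  "exact_travel_polytope n = convex hull {(indicator T, travel_vector n T) | T. tournament n T}"

definition travel_equations :: "nat \<Rightarrow> (nat \<times> nat \<times> nat \<Rightarrow> real) \<Rightarrow> bool" where
  "travel_equations n y \<longleftrightarrow>
     (\<forall>i\<in>teams n. \<forall>t\<in>teams n. i \<noteq> t \<longrightarrow> (\<Sum>j\<in>teams n - {i}. y (t, i, j)) = 1) \<and>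
     (\<forall>j\<in>teams n. \<forall>t\<in>teams n. j \<noteq> t \<longrightarrow> (\<Sum>i\<in>teams n - {j}. y (t, i, j)) = 1)"

definition utt_system ::
    "nat \<Rightarrow> (nat \<times> nat \<times> nat \<Rightarrow> real) \<Rightarrow> (nat \<times> nat \<times> nat \<Rightarrow> real) \<Rightarrow> bool" where
  "utt_system n x y \<longleftrightarrow>
     one_match_per_slot n x \<and>
     each_match_once n x \<and>
     (\<forall>k\<in>slots n - {2 * n - 2}. \<forall>(i, j)\<in>arcs n. \<forall>t\<in>teams n - {i, j}.
        x (k, i, t) + x (k + 1, j, t) - 1 \<le> y (t, i, j)) \<and>
     (\<forall>k\<in>slots n - {2 * n - 2}. \<forall>(t, j)\<in>arcs n.
        (\<Sum>i\<in>teams n - {t}. x (k, t, i)) + x (k + 1, j, t) - 1 \<le> y (t, t, j)) \<and>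
     (\<forall>k\<in>slots n - {1}. \<forall>(i, t)\<in>arcs n.
        x (k - 1, i, t) + (\<Sum>j\<in>teams n - {t}. x (k, t, j)) - 1 \<le> y (t, i, t)) \<and>
     (\<forall>(t, j)\<in>arcs n. x (1, j, t) \<le> y (t, t, j)) \<and>
     (\<forall>(i, t)\<in>arcs n. x (2 * n - 2, i, t) \<le> y (t, i, t)) \<and>
     x \<in> binary_vectors (matches n) \<and>
     y \<in> binary_vectors (teams n \<times> arcs n)"

end

theory Submission
  imports Defs
begin

text \<open>
  The left-hand sides of the travel equations are linear and bounded below by 1 on the generators of
  \<open>P_utt n\<close>, because every team visits every other venue exactly once and hence leaves
  it exactly once and arrives there exactly once. So the equations cut out a face, spanned by the
  generators that satisfy them. Every arc occurs in one of the equations, and the travel vector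
  itself satisfies them; therefore a vector that dominates it and satisfies them is equal to it.
\<close>

section \<open>Faces of a convex hull cut out by tight linear inequalities\<close>

text \<open>The slacks \<open>f i p - c i\<close> are nonnegative on the hull. If a convex
  combination with positive weights has slack 0, then both of its points have slack 0. This gives
  the face property directly and, by induction over the hull, shows that tight points are
  combinations of tight generators.\<close>

lemma
  fixes S :: "'a::real_vector set" and f :: "'b \<Rightarrow> 'a \<Rightarrow> real"
  assumes lin: "\<And>i. i \<in> I \<Longrightarrow> linear (f i)"
    and ge: "\<And>i p. i \<in> I \<Longrightarrow> p \<in> S \<Longrightarrow> c i \<le> f i p"
  shows face_of_convex_hull_tight: "{p \<in> convex hull S. \<forall>i\<in>I. f i p = c i} face_of convex hull S"
    and convex_hull_tight:
      "{p \<in> convex hull S. \<forall>i\<in>I. f i p = c i} = convex hull {p \<in> S. \<forall>i\<in>I. f i p = c i}"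
proof -
  let ?H = "convex hull {p \<in> S. \<forall>i\<in>I. f i p = c i}"
  have comb: "f i (u *\<^sub>R p + v *\<^sub>R q) = u * f i p + v * f i q" if "i \<in> I" for i u v p q
    using lin[OF that] by (simp add: linear_add linear_scale)
  have c_comb: "u * c i + v * c i = c i" if "u + v = 1" for i u v
    using that by (metis distrib_right mult_1)
  have le_comb: "c i \<le> f i (u *\<^sub>R p + v *\<^sub>R q)"
    if "i \<in> I" "c i \<le> f i p" "c i \<le> f i q" "0 \<le> u" "0 \<le> v" "u + v = 1" for i u v p q
    using that mult_left_mono[of "c i" "f i p" u] mult_left_mono[of "c i" "f i q" v]
      c_comb[of u v i] comb[of i u p v q] by linarith
  have tight: "f i p = c i \<and> f i q = c i"
    if "i \<in> I" "c i \<le> f i p" "c i \<le> f i q" "0 < u" "0 < v" "u + v = 1"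
      "f i (u *\<^sub>R p + v *\<^sub>R q) = c i" for i u v p q
  proof -
    have "u * (f i p - c i) + v * (f i q - c i) = 0"
      using that(7) comb[OF that(1), of u p v q] c_comb[OF that(6), of i]
      by (simp only: right_diff_distrib)
    moreover have "0 \<le> u * (f i p - c i)" "0 \<le> v * (f i q - c i)"
      using that by simp_all
    ultimately have "u * (f i p - c i) = 0" "v * (f i q - c i) = 0"
      by linarith+
    then show ?thesis using that by simp
  qed
  \<comment> \<open>Invariant of the hull induction: \<open>?C\<close> is convex and contains
    \<open>S\<close>. Membership in \<open>?H\<close> is only an implication, so that non-tight
    points belong to \<open>?C\<close> as well.\<close>
  let ?C = "{p. (\<forall>i\<in>I. c i \<le> f i p) \<and> ((\<forall>i\<in>I. f i p = c i) \<longrightarrow> p \<in> ?H)}"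
  have "convex ?C"
  proof (rule convexI)
    fix p q and u v :: real
    assume pq: "p \<in> ?C" "q \<in> ?C" and uv: "0 \<le> u" "0 \<le> v" "u + v = 1"
    have "u *\<^sub>R p + v *\<^sub>R q \<in> ?H" if eq: "\<forall>i\<in>I. f i (u *\<^sub>R p + v *\<^sub>R q) = c i"
    proof -
      \<comment> \<open>A point of weight 0 need not be tight, so \<open>tight\<close> requires
        positive weights; in the degenerate cases the combination is the other point itself.\<close>
      consider "u = 0" | "v = 0" | "0 < u" "0 < v" using uv by linarith
      then show ?thesis
      proof cases
        case 3
        then have "\<forall>i\<in>I. f i p = c i \<and> f i q = c i"
          using tight uv pq eq by blast
        then show ?thesis
          using pq uv by (simp add: convexD[OF convex_convex_hull])
      qed (use uv pq eq in auto)
    qed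
    then show "u *\<^sub>R p + v *\<^sub>R q \<in> ?C"
      using le_comb uv pq by blast
  qed
  then have "convex hull S \<subseteq> ?C"
    by (intro hull_minimal) (auto intro: ge hull_inc)
  then have hull: "\<And>p i. p \<in> convex hull S \<Longrightarrow> i \<in> I \<Longrightarrow> c i \<le> f i p"
    "{p \<in> convex hull S. \<forall>i\<in>I. f i p = c i} \<subseteq> ?H"
    by auto
  have conv: "convex {p \<in> convex hull S. \<forall>i\<in>I. f i p = c i}"
    by (rule convexI) (auto simp: comb c_comb convexD[OF convex_convex_hull])
  then have "?H \<subseteq> {p \<in> convex hull S. \<forall>i\<in>I. f i p = c i}"
    by (intro hull_minimal) (auto intro: hull_inc)
  with hull(2) show "{p \<in> convex hull S. \<forall>i\<in>I. f i p = c i} = ?H"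
    by blast
  show "{p \<in> convex hull S. \<forall>i\<in>I. f i p = c i} face_of convex hull S"
    unfolding face_of_def
  proof (intro conjI ballI impI)
    fix a b x
    assume ab: "a \<in> convex hull S" "b \<in> convex hull S"
      and x: "x \<in> {p \<in> convex hull S. \<forall>i\<in>I. f i p = c i}" "x \<in> open_segment a b"
    obtain u where u: "0 < u" "u < 1" "x = (1 - u) *\<^sub>R a + u *\<^sub>R b"
      using x(2) by (auto simp: in_segment)
    have "f i a = c i \<and> f i b = c i" if "i \<in> I" for i
      using tight[of i a b "1 - u" u] hull(1) that ab x(1) u by simp
    with ab show "a \<in> {p \<in> convex hull S. \<forall>i\<in>I. f i p = c i}"
      "b \<in> {p \<in> convex hull S. \<forall>i\<in>I. f i p = c i}"
      by auto
  qed (use conv in auto)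
qed

section \<open>Counting the matches of a team\<close>

lemma finite_teams [simp]: "finite (teams n)"
  and card_teams [simp]: "card (teams n) = n"
  and finite_slots [simp]: "finite (slots n)"
  and card_slots [simp]: "card (slots n) = 2 * n - 2"
  by (simp_all add: teams_def slots_def)

lemma sum_indicator_eq_card:
  "finite A \<Longrightarrow> (\<Sum>a\<in>A. indicator T (g a) :: real) = card {a \<in> A. g a \<in> T}"
  by (simp add: indicator_def sum.If_cases Int_def)

text \<open>For slot 1, this follows by counting: each team plays \<open>2 * n - 2\<close> matches in total.\<close>
lemma one_match_in_slot:
  assumes "2 \<le> n" "one_match_per_slot n x" "each_match_once n x" "k \<in> slots n" "i \<in> teams n"
  shows "(\<Sum>j\<in>teams n - {i}. x (k, i, j) + x (k, j, i)) = 1"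
proof (cases "k = 1")
  case False
  with assms show ?thesis by (auto simp: one_match_per_slot_def slots_def)
next
  case True
  let ?m = "\<lambda>k. \<Sum>j\<in>teams n - {i}. x (k, i, j) + x (k, j, i)"
  have once: "(\<Sum>k\<in>slots n. x (k, i, j)) = 1 \<and> (\<Sum>k\<in>slots n. x (k, j, i)) = 1"
    if "j \<in> teams n - {i}" for j
    using assms(3,5) that by (auto simp: each_match_once_def arcs_def)
  \<comment> \<open>The total weight of the matches of team \<open>i\<close> is counted twice: by
    opponent it is 2 for each of the \<open>n - 1\<close> others; by slot, the slots from 2 on
    contribute \<open>2 * n - 3\<close>, which leaves 1 for slot 1.\<close>
  have "(\<Sum>k\<in>slots n. ?m k)
      = (\<Sum>j\<in>teams n - {i}. (\<Sum>k\<in>slots n. x (k, i, j)) + (\<Sum>k\<in>slots n. x (k, j, i)))"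
    by (subst sum.swap) (simp add: sum.distrib)
  also have "\<dots> = (\<Sum>j\<in>teams n - {i}. 2)"
    using once by (intro sum.cong) auto
  also have "\<dots> = 2 * (real n - 1)"
    using assms(1,5) by (simp add: of_nat_diff)
  finally have total: "(\<Sum>k\<in>slots n. ?m k) = 2 * (real n - 1)" .
  have "(\<Sum>k\<in>slots n - {1}. ?m k) = (\<Sum>k\<in>slots n - {1}. 1)"
    using assms(2,5) by (intro sum.cong) (auto simp: one_match_per_slot_def slots_def)
  also have "\<dots> = 2 * real n - 3"
    using assms(1,4) True by (simp add: of_nat_diff)
  finally show ?thesis
    using total assms(4) True by (simp add: sum.remove)
qed

lemma tournament_subset: "tournament n T \<Longrightarrow> T \<subseteq> matches n"
  by (simp add: tournament_def)

lemma tournament_card_slot: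
  assumes "2 \<le> n" "tournament n T" "k \<in> slots n" "t \<in> teams n"
  shows "card {j \<in> teams n - {t}. (k, t, j) \<in> T} + card {j \<in> teams n - {t}. (k, j, t) \<in> T} = 1"
proof -
  have "(\<Sum>j\<in>teams n - {t}. indicator T (k, t, j) + indicator T (k, j, t)) = (1::real)"
    using assms by (intro one_match_in_slot) (auto simp: tournament_def)
  then show ?thesis
    by (simp add: sum.distrib sum_indicator_eq_card flip: of_nat_add)
qed

section \<open>Venues of a team over time\<close>

text \<open>At the start and the end the venue is \<open>t\<close> by convention. In a slot the home
  opponents \<open>?H\<close> and the away venues \<open>?A\<close> number one in total, so one of
  the two sets is empty and the other is a singleton.\<close>

lemma at_venue_ex1:
  assumes "2 \<le> n" "tournament n T" "t \<in> teams n" "p \<le> 2 * n - 1"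
  shows "\<exists>!v. at_venue n T t p v"
proof (cases "p = 0 \<or> p = 2 * n - 1")
  case True
  then show ?thesis using assms(1) by (auto simp: at_venue_def slots_def)
next
  case False
  then have p: "p \<in> slots n" using assms(4) by (auto simp: slots_def)
  let ?H = "{j \<in> teams n - {t}. (p, t, j) \<in> T}" and ?A = "{j \<in> teams n - {t}. (p, j, t) \<in> T}"
  have venue: "at_venue n T t p v \<longleftrightarrow> v = t \<and> ?H \<noteq> {} \<or> v \<in> ?A" for v
    using False p tournament_subset[OF assms(2)]
    by (auto simp: at_venue_def matches_def arcs_def)
  have "card ?H + card ?A = 1"
    using tournament_card_slot assms p by blast
  then consider "card ?H = 1" "card ?A = 0" | "card ?H = 0" "card ?A = 1"
    by linarith
  then show ?thesis
  proof cases
    case 1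
    have "?H \<noteq> {}"
      using 1(1) by (metis card.empty zero_neq_one)
    moreover have "?A = {}" using 1(2) by simp
    ultimately show ?thesis unfolding venue by blast
  next
    case 2
    then obtain v where A: "?A = {v}" by (meson card_1_singletonE)
    have H: "?H = {}" using 2 by simp
    have "at_venue n T t p w \<longleftrightarrow> w = v" for w
      unfolding venue A H by simp
    then show ?thesis by metis
  qed
qed

lemma at_venue_in_teams:
  "tournament n T \<Longrightarrow> t \<in> teams n \<Longrightarrow> at_venue n T t p v \<Longrightarrow> v \<in> teams n"
  using tournament_subset by (fastforce simp: at_venue_def matches_def arcs_def)

lemma at_venue_away_iff:
  "tournament n T \<Longrightarrow> v \<noteq> t \<Longrightarrow> at_venue n T t p v \<longleftrightarrow> (p, v, t) \<in> T"
  using tournament_subset by (fastforce simp: at_venue_def matches_def)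

text \<open>The \<open>each_match_once\<close> equation of the arc \<open>(v, t)\<close> leaves a
  single slot for this match. Uniqueness is among all positions, since \<open>t\<close> is away from
  home only in slots; the analysis of trips relies on this.\<close>

lemma visits_away_venue_ex1:
  assumes "tournament n T" "t \<in> teams n" "v \<in> teams n" "v \<noteq> t"
  shows "\<exists>!p. at_venue n T t p v"
proof -
  have "(\<Sum>k\<in>slots n. indicator T (k, v, t)) = (1::real)"
    using assms by (auto simp: tournament_def each_match_once_def arcs_def)
  then have "card {k \<in> slots n. (k, v, t) \<in> T} = 1"
    by (simp add: sum_indicator_eq_card)
  then obtain p where p: "{k \<in> slots n. (k, v, t) \<in> T} = {p}"
    by (meson card_1_singletonE)
  have "(k, v, t) \<in> T \<longleftrightarrow> k \<in> {p}" for k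
    unfolding p[symmetric] using tournament_subset[OF assms(1)] by (auto simp: matches_def)
  then show ?thesis
    using assms by (simp add: at_venue_away_iff)
qed

section \<open>Departures and arrivals\<close>

text \<open>The only position \<open>p\<close> with \<open>t\<close> at \<open>i\<close> is not the
  end, because \<open>i \<noteq> t\<close>, so a next position exists. Its venue is unique and
  differs from \<open>i\<close>, since \<open>i\<close> is visited only at \<open>p\<close>.\<close>

lemma leaves_venue_ex1:
  assumes "2 \<le> n" "tournament n T" "t \<in> teams n" "i \<in> teams n" "i \<noteq> t"
  shows "\<exists>!j. travels n T t i j"
proof -
  obtain p where p: "at_venue n T t p i" "\<And>q. at_venue n T t q i \<Longrightarrow> q = p"
    using visits_away_venue_ex1 assms by metis
  have le: "p \<le> 2 * n - 2"
    using p(1) assms(5) by (auto simp: at_venue_def slots_def)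
  then have "Suc p \<le> 2 * n - 1" using assms(1) by linarith
  then obtain v where v: "at_venue n T t (Suc p) v" "\<And>w. at_venue n T t (Suc p) w \<Longrightarrow> w = v"
    using at_venue_ex1[OF assms(1-3)] by metis
  have "v \<noteq> i" using p(2) v(1) by (metis n_not_Suc_n)
  then show ?thesis unfolding travels_def using p v le by metis
qed

text \<open>Mirror image of \<open>leaves_venue_ex1\<close>: the only position \<open>q\<close> with
  \<open>t\<close> at \<open>j\<close> is a slot, hence not the start, and has a
  predecessor.\<close>

lemma reaches_venue_ex1:
  assumes "2 \<le> n" "tournament n T" "t \<in> teams n" "j \<in> teams n" "j \<noteq> t"
  shows "\<exists>!i. travels n T t i j"
proof -
  obtain q where q: "at_venue n T t q j" "\<And>r. at_venue n T t r j \<Longrightarrow> r = q"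
    using visits_away_venue_ex1 assms by metis
  have "q \<in> slots n"
    using q(1) assms(5) by (auto simp: at_venue_def)
  then obtain p where p: "q = Suc p" "p \<le> 2 * n - 2"
    by (cases q) (auto simp: slots_def)
  then obtain v where v: "at_venue n T t p v" "\<And>w. at_venue n T t p w \<Longrightarrow> w = v"
    using at_venue_ex1[OF assms(1-3), of p] by force
  have "v \<noteq> j" using q(2) v(1) p(1) by (metis n_not_Suc_n)
  then show ?thesis unfolding travels_def using p q v by (metis Suc_inject)
qed

section \<open>Travel vectors and the travel equations\<close>

lemma travels_in_arcs:
  "tournament n T \<Longrightarrow> t \<in> teams n \<Longrightarrow> travels n T t i j \<Longrightarrow> (i, j) \<in> arcs n"
  using at_venue_in_teams by (auto simp: travels_def arcs_def)

lemma travel_vector_binary: "travel_vector n T \<in> binary_vectors (teams n \<times> arcs n)"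
  by (auto simp: binary_vectors_def travel_vector_def indicator_def)

lemma travel_vector_eq:
  assumes "tournament n T" "t \<in> teams n"
  shows "travel_vector n T (t, i, j) = of_bool (travels n T t i j)"
  using travels_in_arcs[OF assms] assms(2) by (auto simp: travel_vector_def)

lemma sum_of_bool_ex1:
  assumes "finite A" "\<exists>!a. P a" "\<And>a. P a \<Longrightarrow> a \<in> A"
  shows "(\<Sum>a\<in>A. of_bool (P a) :: real) = 1"
proof -
  obtain a where "P b \<longleftrightarrow> b = a" for b using assms(2) by metis
  then show ?thesis using assms(1,3) by simp
qed

lemma travel_equations_travel_vector:
  assumes "2 \<le> n" "tournament n T"
  shows "travel_equations n (travel_vector n T)"
  unfolding travel_equations_def
proof (intro conjI ballI impI)
  fix v t assume vt: "v \<in> teams n" "t \<in> teams n" "v \<noteq> t"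
  show "(\<Sum>j\<in>teams n - {v}. travel_vector n T (t, v, j)) = 1"
    using leaves_venue_ex1[OF assms vt(2,1,3)] travels_in_arcs[OF assms(2) vt(2)]
    by (subst travel_vector_eq[OF assms(2) vt(2)], intro sum_of_bool_ex1) (auto simp: arcs_def)
  show "(\<Sum>i\<in>teams n - {v}. travel_vector n T (t, i, v)) = 1"
    using reaches_venue_ex1[OF assms vt(2,1,3)] travels_in_arcs[OF assms(2) vt(2)]
    by (subst travel_vector_eq[OF assms(2) vt(2)], intro sum_of_bool_ex1) (auto simp: arcs_def)
qed

lemma travel_equations_unique:
  assumes y: "travel_equations n y" "y \<in> binary_vectors (teams n \<times> arcs n)"
    and z: "travel_equations n z" "z \<in> binary_vectors (teams n \<times> arcs n)"
    and "y \<le> z"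
  shows "y = z"
proof
  fix a :: "nat \<times> nat \<times> nat"
  obtain t i j where a: "a = (t, i, j)" by (cases a)
  have le: "y b \<le> z b" for b using \<open>y \<le> z\<close> by (rule le_funD)
  show "y a = z a"
  proof (cases "t \<in> teams n \<and> (i, j) \<in> arcs n")
    case False
    then show ?thesis using y(2) z(2) by (simp add: binary_vectors_def a)
  next
    case True
    then have ij: "t \<in> teams n" "i \<in> teams n" "j \<in> teams n" "i \<noteq> j"
      by (auto simp: arcs_def)
    \<comment> \<open>At most one end of the arc is the home venue \<open>t\<close>, so the
      coordinate occurs in an outgoing or in an incoming equation. There, equal sums of termwise
      comparable summands force termwise equality.\<close>
    then consider "i \<noteq> t" | "j \<noteq> t" by auto
    then show ?thesis
    proof cases
      case 1
      then have "(\<Sum>j\<in>teams n - {i}. y (t, i, j)) = (\<Sum>j\<in>teams n - {i}. z (t, i, j))"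
        using ij y(1) z(1) by (simp add: travel_equations_def)
      from sum_mono_inv[OF this, of j] show ?thesis using ij le a by simp
    next
      case 2
      then have "(\<Sum>i\<in>teams n - {j}. y (t, i, j)) = (\<Sum>i\<in>teams n - {j}. z (t, i, j))"
        using ij y(1) z(1) by (simp add: travel_equations_def)
      from sum_mono_inv[OF this, of i] show ?thesis using ij le a by simp
    qed
  qed
qed

section \<open>The inequality system on incidence vectors\<close>

text \<open>A team plays at most one home match per slot, so the sum is 0 or 1. This turns the home
  sums of (F3) and (F4) into venue indicators, the same form that single away matches have.\<close>

lemma sum_home_eq_of_bool:
  assumes "2 \<le> n" "tournament n T" "k \<in> slots n" "t \<in> teams n"
  shows "(\<Sum>j\<in>teams n - {t}. indicator T (k, t, j)) = (of_bool (at_venue n T t k t) :: real)"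
proof -
  let ?H = "{j \<in> teams n - {t}. (k, t, j) \<in> T}"
  have "at_venue n T t k t \<longleftrightarrow> ?H \<noteq> {}"
    using assms(1,3) by (auto simp: at_venue_def slots_def)
  moreover have "card ?H \<le> 1"
    using tournament_card_slot[OF assms] by linarith
  moreover have "card ?H = 0 \<longleftrightarrow> ?H = {}" by simp
  ultimately have "card ?H = of_bool (at_venue n T t k t)"
    by (cases "card ?H = 0") (auto simp del: card_0_eq)
  then show ?thesis by (simp add: sum_indicator_eq_card)
qed

text \<open>The inequalities (F2)--(F6) are the five ways in which a team can travel: away to away,
  home to away, away to home, and the first and the last trip of the tournament.\<close>
lemma utt_system_indicator_iff:
  assumes "2 \<le> n" "tournament n T" "y \<in> binary_vectors (teams n \<times> arcs n)"
  shows "utt_system n (indicator T) y \<longleftrightarrow> travel_vector n T \<le> y"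
proof -
  have nonneg: "0 \<le> y (t, i, j)" for t i j
    using assms(3) by (cases "t \<in> teams n \<and> (i, j) \<in> arcs n"; force simp: binary_vectors_def)
  have away: "indicator T (p, v, t) = (of_bool (at_venue n T t p v) :: real)"
    if "v \<noteq> t" for p v t
    using at_venue_away_iff[OF assms(2) that] by (simp add: indicator_def)
  show ?thesis
  proof
    assume sys: "utt_system n (indicator T) y"
    have "travel_vector n T (t, i, j) \<le> y (t, i, j)" for t i j
    proof (cases "t \<in> teams n \<and> travels n T t i j")
      case False
      then show ?thesis by (auto simp: travel_vector_def nonneg)
    next
      case True
      then have t: "t \<in> teams n" by simp
      obtain p where p: "i \<noteq> j" "p \<le> 2 * n - 2" "at_venue n T t p i" "at_venue n T t (Suc p) j"
        using True by (auto simp: travels_def)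
      have ij: "i \<in> teams n" "j \<in> teams n"
        using p t at_venue_in_teams assms(2) by blast+
      \<comment> \<open>A trip from the start is covered by (F5) and a trip to the end by (F6).
        Otherwise both positions are slots, and (F2), (F3) or (F4) applies according to which end of
        the trip, if any, is \<open>t\<close>.\<close>
      consider (first) "p = 0" | (last) "p = 2 * n - 2" "p \<noteq> 0"
        | (mid) "p \<in> slots n - {2 * n - 2}" "Suc p \<in> slots n - {1}"
        using p(2) by (fastforce simp: slots_def)
      then have "1 \<le> y (t, i, j)"
      proof cases
        case first
        then have "i = t" using p(3) by (auto simp: at_venue_def slots_def)
        moreover have "indicator T (1, j, t) \<le> y (t, t, j)"
          using sys t ij p(1) \<open>i = t\<close> by (auto simp: utt_system_def arcs_def)
        ultimately show ?thesis using p away[of j t 1] first by simp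
      next
        case last
        then have "j = t" using p(4) assms(1) by (auto simp: at_venue_def slots_def)
        moreover have "indicator T (2 * n - 2, i, t) \<le> y (t, i, t)"
          using sys t ij p(1) \<open>j = t\<close> by (auto simp: utt_system_def arcs_def)
        ultimately show ?thesis using p away[of i t "2 * n - 2"] last by simp
      next
        case mid
        consider "i = t" | "j = t" | "i \<noteq> t" "j \<noteq> t" by blast
        then show ?thesis
        proof cases
          case 1
          then have "(\<Sum>i\<in>teams n - {t}. indicator T (p, t, i)) + indicator T (p + 1, j, t) - 1
              \<le> y (t, t, j)"
            using sys t ij p(1) mid by (auto simp: utt_system_def arcs_def)
          then show ?thesis
            using 1 p mid t sum_home_eq_of_bool[OF assms(1,2), of p t] away[of j t "p + 1"] by simp
        next
          case 2
          \<comment> \<open>(F4) is indexed by the slot after the trip, so it is instantiated at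
            \<open>Suc p\<close>.\<close>
          then have "(i, t) \<in> arcs n" using t ij p(1) by (auto simp: arcs_def)
          then have "indicator T (Suc p - 1, i, t) + (\<Sum>j\<in>teams n - {t}. indicator T (Suc p, t, j)) - 1
              \<le> y (t, i, t)"
            using sys mid(2) unfolding utt_system_def by blast
          then show ?thesis
            using 2 p mid t sum_home_eq_of_bool[OF assms(1,2), of "Suc p" t] away[of i t p] by simp
        next
          case 3
          then have "indicator T (p, i, t) + indicator T (p + 1, j, t) - 1 \<le> y (t, i, j)"
            using sys t ij p(1) mid by (auto simp: utt_system_def arcs_def)
          then show ?thesis
            using 3 p away[of i t p] away[of j t "p + 1"] by simp
        qed
      qed
      then show ?thesis using True assms(2) by (simp add: travel_vector_eq)
    qed
    then show "travel_vector n T \<le> y" by (auto simp: le_fun_def)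
  next
    assume le: "travel_vector n T \<le> y"
    \<comment> \<open>Common form of (F2)-(F6): either both indicators are 1 and the trip takes
      place, so that \<open>y\<close> is at least 1, or the left-hand side is at most 0.\<close>
    have y1: "of_bool (at_venue n T t p i) + of_bool (at_venue n T t (Suc p) j) - 1 \<le> y (t, i, j)"
      if "t \<in> teams n" "i \<noteq> j" "p \<le> 2 * n - 2" for t i j p
    proof (cases "at_venue n T t p i \<and> at_venue n T t (Suc p) j")
      case True
      then have "travels n T t i j" using that by (auto simp: travels_def)
      moreover have "travel_vector n T (t, i, j) \<le> y (t, i, j)"
        using le by (simp add: le_fun_def)
      ultimately show ?thesis
        using True that assms(2) by (simp add: travel_vector_eq)
    next
      case False
      then show ?thesis using nonneg[of t i j] by auto
    qed
    \<comment> \<open>At the two ends one venue indicator is constantly 1 and cancels the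
      \<open>- 1\<close> in \<open>y1\<close>, which yields (F5) and (F6).\<close>
    have start: "at_venue n T t 0 t" and stop: "at_venue n T t (Suc (2 * n - 2)) t" for t
      using assms(1) by (auto simp: at_venue_def)
    show "utt_system n (indicator T) y"
      unfolding utt_system_def
    proof (intro conjI)
      show "one_match_per_slot n (indicator T)" "each_match_once n (indicator T)"
        using assms(2) by (simp_all add: tournament_def)
      show "y \<in> binary_vectors (teams n \<times> arcs n)" by fact
      show "indicator T \<in> binary_vectors (matches n)"
        using tournament_subset[OF assms(2)] by (auto simp: binary_vectors_def indicator_def)
      show "\<forall>k\<in>slots n - {2 * n - 2}. \<forall>(i, j)\<in>arcs n. \<forall>t\<in>teams n - {i, j}.
          indicator T (k, i, t) + indicator T (k + 1, j, t) - 1 \<le> y (t, i, j)"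
      proof (intro ballI case_prodI2)
        fix k a i j t
        assume "k \<in> slots n - {2 * n - 2}" "a \<in> arcs n" "a = (i, j)" "t \<in> teams n - {i, j}"
        then show "indicator T (k, i, t) + indicator T (k + 1, j, t) - 1 \<le> y (t, i, j)"
          using y1[of t i j k] away[of i t k] away[of j t "k + 1"]
          by (simp add: arcs_def slots_def)
      qed
      show "\<forall>k\<in>slots n - {2 * n - 2}. \<forall>(t, j)\<in>arcs n.
          (\<Sum>i\<in>teams n - {t}. indicator T (k, t, i)) + indicator T (k + 1, j, t) - 1 \<le> y (t, t, j)"
      proof (intro ballI case_prodI2)
        fix k a t j
        assume "k \<in> slots n - {2 * n - 2}" "a \<in> arcs n" "a = (t, j)"
        then show "(\<Sum>i\<in>teams n - {t}. indicator T (k, t, i)) + indicator T (k + 1, j, t) - 1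
            \<le> y (t, t, j)"
          using y1[of t t j k] away[of j t "k + 1"] sum_home_eq_of_bool[OF assms(1,2), of k t]
          by (simp add: arcs_def slots_def)
      qed
      show "\<forall>k\<in>slots n - {1}. \<forall>(i, t)\<in>arcs n.
          indicator T (k - 1, i, t) + (\<Sum>j\<in>teams n - {t}. indicator T (k, t, j)) - 1 \<le> y (t, i, t)"
      proof (intro ballI case_prodI2)
        fix k a i t
        assume "k \<in> slots n - {1}" "a \<in> arcs n" "a = (i, t)"
        then show "indicator T (k - 1, i, t) + (\<Sum>j\<in>teams n - {t}. indicator T (k, t, j)) - 1
            \<le> y (t, i, t)"
          \<comment> \<open>Here \<open>k\<close> is at least 2, so
            \<open>Suc (k - 1) = k\<close>.\<close>
          using y1[of t i t "k - 1"] away[of i t "k - 1"] sum_home_eq_of_bool[OF assms(1,2), of k t]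
          by (auto simp: arcs_def slots_def)
      qed
      show "\<forall>(t, j)\<in>arcs n. indicator T (1, j, t) \<le> y (t, t, j)"
      proof clarify
        fix t j assume "(t, j) \<in> arcs n"
        then show "indicator T (1, j, t) \<le> y (t, t, j)"
          using y1[of t t j 0] start[of t] away[of j t 1] by (simp add: arcs_def)
      qed
      show "\<forall>(i, t)\<in>arcs n. indicator T (2 * n - 2, i, t) \<le> y (t, i, t)"
      proof clarify
        fix i t assume "(i, t) \<in> arcs n"
        then show "indicator T (2 * n - 2, i, t) \<le> y (t, i, t)"
          using y1[of t i t "2 * n - 2"] stop[of t] away[of i t "2 * n - 2"] by (simp add: arcs_def)
      qed
    qed
  qed
qed

text \<open>A binary vector is the indicator of the set where it equals 1, and (F0) and (F1) make
  this set a tournament.\<close>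

lemma utt_system_imp_tournament:
  assumes "utt_system n x y"
  shows "\<exists>T. tournament n T \<and> x = indicator T"
proof -
  have bin: "x \<in> binary_vectors (matches n)" using assms by (simp add: utt_system_def)
  have x: "x = indicator {m. x m = 1}"
    using bin by (fastforce simp: binary_vectors_def indicator_def fun_eq_iff)
  have "{m. x m = 1} \<subseteq> matches n"
    using bin by (force simp: binary_vectors_def)
  then have "tournament n {m. x m = 1}"
    using assms x by (simp add: tournament_def utt_system_def)
  with x show ?thesis by blast
qed

section \<open>The face and the integer programming formulation\<close>

lemma linear_eval_sum: "linear (\<lambda>p :: 'a::real_vector \<times> ('b \<Rightarrow> real). \<Sum>j\<in>A. snd p (g j))"
  by (rule linearI) (simp_all add: sum.distrib scaleR_fun_def sum_distrib_left)

theorem theorem16: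
  fixes n :: nat
    and F :: "((nat \<times> nat \<times> nat \<Rightarrow> real) \<times> (nat \<times> nat \<times> nat \<Rightarrow> real)) set"
  assumes "n \<ge> 4" and "even n"
    and "F = {(x, y) \<in> P_utt n. travel_equations n y}"
  shows "F face_of P_utt n \<and>
    F = exact_travel_polytope n \<and>
    convex hull {(x, y). utt_system n x y \<and> travel_equations n y} = exact_travel_polytope n"
proof -
  have n: "2 \<le> n" using assms(1) by simp
  define G :: "((nat \<times> nat \<times> nat \<Rightarrow> real) \<times> (nat \<times> nat \<times> nat \<Rightarrow> real)) set" where
    "G = {(indicator T, y) | T y.
        tournament n T \<and> y \<in> binary_vectors (teams n \<times> arcs n) \<and> travel_vector n T \<le> y}"
  define E :: "((nat \<times> nat \<times> nat \<Rightarrow> real) \<times> (nat \<times> nat \<times> nat \<Rightarrow> real)) set" where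
    "E = {(indicator T, travel_vector n T) | T. tournament n T}"
  \<comment> \<open>The functionals serve as their own index set: the convex hull lemma is applied
    with \<open>I = L\<close>, the identity as \<open>f\<close>, and all right-hand sides 1.\<close>
  define L :: "((nat \<times> nat \<times> nat \<Rightarrow> real) \<times> (nat \<times> nat \<times> nat \<Rightarrow> real) \<Rightarrow> real) set" where
    "L = {\<lambda>p. \<Sum>j\<in>teams n - {i}. snd p (t, i, j) | i t. i \<in> teams n \<and> t \<in> teams n \<and> i \<noteq> t} \<union>
         {\<lambda>p. \<Sum>i\<in>teams n - {j}. snd p (t, i, j) | j t. j \<in> teams n \<and> t \<in> teams n \<and> j \<noteq> t}"
  have L: "travel_equations n (snd p) \<longleftrightarrow> (\<forall>f\<in>L. f p = 1)" for p
    unfolding L_def travel_equations_def by fast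
  have lin: "linear f" if "f \<in> L" for f
    using that by (auto simp: L_def intro: linear_eval_sum)
  have ge: "1 \<le> f p" if "f \<in> L" "p \<in> G" for f p
  proof -
    obtain T where T: "tournament n T" "travel_vector n T \<le> snd p"
      using \<open>p \<in> G\<close> by (auto simp: G_def)
    \<comment> \<open>Functionals in \<open>L\<close> read only the second component. At the travel
      vector they equal 1, and passing to the dominating \<open>snd p\<close> cannot decrease
      them.\<close>
    have "f (fst p, travel_vector n T) = 1"
      using L[of "(fst p, travel_vector n T)"] travel_equations_travel_vector[OF n T(1)] that
      by simp
    moreover have "f (fst p, travel_vector n T) \<le> f p"
      using \<open>f \<in> L\<close> T(2) by (auto simp: L_def le_fun_def intro!: sum_mono)
    ultimately show ?thesis by simp
  qed
  have tight: "y = travel_vector n T"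
    if "tournament n T" "y \<in> binary_vectors (teams n \<times> arcs n)" "travel_vector n T \<le> y"
      "travel_equations n y" for T y
    using travel_equations_unique[of n "travel_vector n T" y] that n
      travel_equations_travel_vector travel_vector_binary by blast
  have "{p \<in> G. travel_equations n (snd p)} = E"
    using tight n travel_equations_travel_vector travel_vector_binary
    by (fastforce simp: G_def E_def)
  \<comment> \<open>The feasible points coincide with the generators \<open>E\<close> even before
    hulls are taken, so the claim about the integer program follows at once.\<close>
  moreover have "{(x, y). utt_system n x y \<and> travel_equations n y} = E"
  proof (intro equalityI subsetI)
    fix p assume "p \<in> {(x, y). utt_system n x y \<and> travel_equations n y}"
    then obtain x y where p: "p = (x, y)" "utt_system n x y" "travel_equations n y" by auto
    then obtain T where T: "tournament n T" "x = indicator T"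
      using utt_system_imp_tournament by blast
    have bin: "y \<in> binary_vectors (teams n \<times> arcs n)"
      using p(2) by (simp add: utt_system_def)
    have "travel_vector n T \<le> y"
      using p(2) T utt_system_indicator_iff[OF n T(1) bin] by simp
    then show "p \<in> E" using tight T bin p by (auto simp: E_def)
  next
    fix p assume "p \<in> E"
    then show "p \<in> {(x, y). utt_system n x y \<and> travel_equations n y}"
      using n travel_equations_travel_vector travel_vector_binary utt_system_indicator_iff
      by (auto simp: E_def)
  qed
  moreover have "F = {p \<in> convex hull G. \<forall>f\<in>L. f p = 1}"
    using assms(3) by (auto simp: P_utt_def G_def simp flip: L)
  moreover have "P_utt n = convex hull G" "exact_travel_polytope n = convex hull E"
    by (simp_all add: P_utt_def exact_travel_polytope_def G_def E_def)
  moreover have "{p \<in> convex hull G. \<forall>f\<in>L. f p = 1} face_of convex hull G"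
    by (rule face_of_convex_hull_tight[of L "\<lambda>f. f" G "\<lambda>_. 1"]) (fact lin ge)+
  moreover have "{p \<in> convex hull G. \<forall>f\<in>L. f p = 1} = convex hull {p \<in> G. \<forall>f\<in>L. f p = 1}"
    by (rule convex_hull_tight[of L "\<lambda>f. f" G "\<lambda>_. 1"]) (fact lin ge)+
  ultimately show ?thesis
    by (simp only: L)
qed

end
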